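(* Let $S\subseteq\mathbb N^2$ be a (local) good semigroup and let $\mathrm{Ap}(S)=\bigcup_{i=1}^e A_i$ be the partition of its Apéry set into levels. For $\omega\in\mathbb Z^2$ write $\omega'=\boldsymbol\gamma+\boldsymbol e-\omega$, and set $$A_i'=\Big(\bigcup_{\omega\in A_i}\Delta^S(\omega')\Big)\setminus\Big(\bigcup_{\omega\in A_j,\ j<i}\Delta^S(\omega')\Big).$$ The following assertions are equivalent: (1) $S$ is symmetric. (2) $A_i'=A_{e-i+1}$ for every $i=1,\dots,e$.
   Context: $\mathbb N$ is the set of nonnegative integers. On $\mathbb Z^2$, $\alpha\le\beta$ is the componentwise order; $\alpha\wedge\beta$ is the componentwise minimum; $\alpha\ll\beta$ means $\alpha_1<\beta_1$ and $\alpha_2<\beta_2$; $\alpha\le\le\beta$ means $\alpha=\beta$ or $\alpha\ll\beta$. A good semigroup is a submonoid $S$ of $(\mathbb N^2,+)$ such that: (G1) $\alpha,\beta\in S\Rightarrow\alpha\wedge\beta\in S$; (G2) if $\alpha,\beta\in S$ and $\alpha_i=\beta_i$ for some $i\in\{1,2\}$, where $j$ is the other index, then there is $\delta\in S$ with $\delta_i>\alpha_i=\beta_i$, $\delta_j\ge\min\{\alpha_j,\beta_j\}$, and $\delta_j=\min\{\alpha_j,\beta_j\}$ if $\alpha_j\neq\beta_j$; (G3) there is $c\in S$ with $c+\mathbb N^2\subseteq S$. All good semigroups are assumed local: $(0,0)$ is the only element with a zero component. $\boldsymbol e=(e_1,e_2)$ is the minimum of $S\setminus\{(0,0)\}$,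 and $\mathrm{Ap}(S)=\{\alpha\in S:\alpha-\boldsymbol e\notin S\}$. The conductor is $\boldsymbol c=\min\{\alpha\in\mathbb Z^2:\alpha+\mathbb N^2\subseteq S\}$ and $\boldsymbol\gamma=\boldsymbol c-(1,1)$. For $\alpha\in\mathbb Z^2$, $\Delta^S(\alpha)$ is the set of $\beta\in S$ such that ($\beta_1=\alpha_1$ and $\beta_2>\alpha_2$) or ($\beta_2=\alpha_2$ and $\beta_1>\alpha_1$). $S$ is symmetric if for every $\alpha\in\mathbb N^2$: $\alpha\in S\iff\Delta^S(\boldsymbol\gamma-\alpha)=\emptyset$. Levels: for $i\ge1$, having defined $D^{(1)},\dots,D^{(i-1)}$, let $B^{(i)}$ be the set of elements of $\mathrm{Ap}(S)\setminus\bigcup_{j<i}D^{(j)}$ maximal in it with respect to $\le\le$, let $C^{(i)}=\{\alpha\in B^{(i)}:\alpha=\beta_1\wedge\beta_2\text{ for some }\beta_1,\beta_2\in B^{(i)}\setminus\{\alpha\}\}$, and $D^{(i)}=B^{(i)}\setminus C^{(i)}$. For some least $N$, $\mathrm{Ap}(S)$ is the disjoint union of $D^{(1)},\dots,D^{(N)}$, and $A_i=D^{(N+1-i)}$. It is a fact that $N=e_1+e_2$; this number is denoted $e$. *)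

theory Defs
  imports Main "HOL-Library.Product_Order" "HOL-Library.Product_Plus"
begin

text \<open>
  Points of $Z^2$ are pairs of integers with the componentwise order and group structure, so that
  \<open>inf\<close> is the componentwise minimum. A good semigroup is a set of such points with
  nonnegative components.
\<close>

type_synonym point = "int \<times> int"

definition strictly_below :: "point \<Rightarrow> point \<Rightarrow> bool"  (infix "\<lless>" 50)
  where "\<alpha> \<lless> \<beta> \<longleftrightarrow> fst \<alpha> < fst \<beta> \<and> snd \<alpha> < snd \<beta>"

definition below_eq :: "point \<Rightarrow> point \<Rightarrow> bool"  (infix "\<lless>\<^sub>=" 50)
  where "\<alpha> \<lless>\<^sub>= \<beta> \<longleftrightarrow> \<alpha> = \<beta> \<or> \<alpha> \<lless> \<beta>"

definition good_semigroup :: "point set \<Rightarrow> bool" where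
  "good_semigroup S \<longleftrightarrow>
     S \<subseteq> {\<alpha>. 0 \<le> \<alpha>} \<and> 0 \<in> S \<and> (\<forall>\<alpha>\<in>S. \<forall>\<beta>\<in>S. \<alpha> + \<beta> \<in> S) \<and>
     (\<forall>\<alpha>\<in>S. \<forall>\<beta>\<in>S. inf \<alpha> \<beta> \<in> S) \<and>
     (\<forall>\<alpha>\<in>S. \<forall>\<beta>\<in>S. fst \<alpha> = fst \<beta> \<longrightarrow>
        (\<exists>\<delta>\<in>S. fst \<delta> > fst \<alpha> \<and> snd \<delta> \<ge> min (snd \<alpha>) (snd \<beta>) \<and>
           (snd \<alpha> \<noteq> snd \<beta> \<longrightarrow> snd \<delta> = min (snd \<alpha>) (snd \<beta>)))) \<and>
     (\<forall>\<alpha>\<in>S. \<forall>\<beta>\<in>S. snd \<alpha> = snd \<beta> \<longrightarrow>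
        (\<exists>\<delta>\<in>S. snd \<delta> > snd \<alpha> \<and> fst \<delta> \<ge> min (fst \<alpha>) (fst \<beta>) \<and>
           (fst \<alpha> \<noteq> fst \<beta> \<longrightarrow> fst \<delta> = min (fst \<alpha>) (fst \<beta>)))) \<and>
     (\<exists>c\<in>S. \<forall>\<nu>\<ge>0. c + \<nu> \<in> S)"

definition local_semigroup :: "point set \<Rightarrow> bool" where
  "local_semigroup S \<longleftrightarrow> (\<forall>\<alpha>\<in>S. fst \<alpha> = 0 \<or> snd \<alpha> = 0 \<longrightarrow> \<alpha> = 0)"

text \<open>
  \<open>LEAST\<close> below refers to the componentwise partial order, so it is a genuine minimum. The minima
  exist for every local good semigroup, because the sets in question are nonempty, bounded below
  and closed under \<open>inf\<close>.
\<close>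

definition multiplicity_vector :: "point set \<Rightarrow> point" where
  "multiplicity_vector S = (LEAST \<alpha>. \<alpha> \<in> S - {0})"

definition conductor :: "point set \<Rightarrow> point" where
  "conductor S = (LEAST \<alpha>. \<forall>\<nu>\<ge>0. \<alpha> + \<nu> \<in> S)"

definition gamma :: "point set \<Rightarrow> point" where
  "gamma S = conductor S - (1, 1)"

definition Apery :: "point set \<Rightarrow> point set" where
  "Apery S = {\<alpha>\<in>S. \<alpha> - multiplicity_vector S \<notin> S}"

definition Delta :: "point set \<Rightarrow> point \<Rightarrow> point set" where
  "Delta S \<alpha> = {\<beta>\<in>S. fst \<beta> = fst \<alpha> \<and> snd \<beta> > snd \<alpha> \<or> snd \<beta> = snd \<alpha> \<and> fst \<beta> > fst \<alpha>}"

definition symmetric :: "point set \<Rightarrow> bool" where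
  "symmetric S \<longleftrightarrow> (\<forall>\<alpha>\<ge>0. \<alpha> \<in> S \<longleftrightarrow> Delta S (gamma S - \<alpha>) = {})"

definition maximal_elements :: "point set \<Rightarrow> point set" where
  "maximal_elements X = {\<alpha>\<in>X. \<forall>\<beta>\<in>X. \<alpha> \<lless>\<^sub>= \<beta> \<longrightarrow> \<beta> = \<alpha>}"

definition meets_of_others :: "point set \<Rightarrow> point set" where
  "meets_of_others B = {\<alpha>\<in>B. \<exists>\<beta>\<^sub>1\<in>B - {\<alpha>}. \<exists>\<beta>\<^sub>2\<in>B - {\<alpha>}. \<alpha> = inf \<beta>\<^sub>1 \<beta>\<^sub>2}"

text \<open>
  \<open>top_level S i\<close> is $D^{(i)}$, numbered from \<open>i = 1\<close>; the recursion makes \<open>top_level S 0\<close> equal to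
  \<open>top_level S 1\<close>, but index \<open>0\<close> is never used.
\<close>

function top_level :: "point set \<Rightarrow> nat \<Rightarrow> point set" where
  "top_level S i =
     (let B = maximal_elements (Apery S - (\<Union>j\<in>{1..<i}. top_level S j))
      in B - meets_of_others B)"
  by pat_completeness auto
termination by (relation "measure snd") auto

declare top_level.simps [simp del]

definition num_levels :: "point set \<Rightarrow> nat" where
  "num_levels S = (LEAST N. Apery S = (\<Union>i\<in>{1..N}. top_level S i))"

text \<open>The levels $A_1, \dots, A_N$ in increasing order.\<close>

definition level :: "point set \<Rightarrow> nat \<Rightarrow> point set" where
  "level S i = top_level S (num_levels S + 1 - i)"

definition reflect :: "point set \<Rightarrow> point \<Rightarrow> point" where
  "reflect S \<omega> = gamma S + multiplicity_vector S - \<omega>"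

definition dual_level :: "point set \<Rightarrow> nat \<Rightarrow> point set" where
  "dual_level S i =
     (\<Union>\<omega>\<in>level S i. Delta S (reflect S \<omega>)) -
     (\<Union>j\<in>{1..<i}. \<Union>\<omega>\<in>level S j. Delta S (reflect S \<omega>))"

end

theory Submission
  imports Defs
begin

text \<open>
  Filter \<open>S\<close> by the sets of its elements \<open>\<ge> \<alpha>\<close>: passing from \<open>(x, y)\<close> to
  \<open>(x + 1, y)\<close> loses length one if \<open>S\<close> has an element \<open>(x, b)\<close> with \<open>b \<ge> y\<close>, and length zero
  otherwise. By (G1) and (G2) the total length lost between two points does not depend on the
  lattice path joining them. Let \<open>\<ell> \<alpha>\<close> (\<open>rlen\<close> below) be the length lost by \<open>S\<close> up to \<open>\<alpha>\<close> minus the length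
  lost by the ideal $\boldsymbol e + S$. Then \<open>\<ell>\<close> is monotone, and on the Apery set it determines
  the level: \<open>\<alpha>\<close> lies in $A_i$ iff \<open>\<ell> \<alpha> = i - 1\<close>.

  If \<open>S\<close> is symmetric, each step of \<open>\<ell>\<close> at \<open>\<alpha>\<close> is matched by the reflected step, so
  $\ell(\alpha) + \ell(\boldsymbol c + \boldsymbol e - \alpha)$ is constant, and this gives the
  duality of the levels. Conversely, the duality implies that $\Delta^S(\omega')$ is nonempty for
  every \<open>\<omega>\<close> in the Apery set; every \<open>\<alpha> \<notin> S\<close> has a translate by a multiple of $\boldsymbol e$ of
  the form $\omega - \boldsymbol e$ with such an \<open>\<omega>\<close>, which gives symmetry.
\<close>

section \<open>Minima and the conductor\<close>

text \<open>Minimize the two components separately; the meet of the two minimizers is the least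
  point. Nonnegativity lets \<open>nat\<close> reflect the order of the components.\<close>

lemma ex_least_point:
  fixes X :: "point set"
  assumes "X \<noteq> {}" and nonneg: "\<And>\<alpha>. \<alpha> \<in> X \<Longrightarrow> 0 \<le> \<alpha>"
    and inf: "\<And>\<alpha> \<beta>. \<alpha> \<in> X \<Longrightarrow> \<beta> \<in> X \<Longrightarrow> inf \<alpha> \<beta> \<in> X"
  shows "\<exists>\<mu>\<in>X. \<forall>\<alpha>\<in>X. \<mu> \<le> \<alpha>"
proof -
  obtain \<alpha> where a: "\<alpha> \<in> X" "\<And>\<beta>. \<beta> \<in> X \<Longrightarrow> nat (fst \<alpha>) \<le> nat (fst \<beta>)"
    using ex_has_least_nat[of "\<lambda>\<alpha>. \<alpha> \<in> X" _ "\<lambda>\<alpha>. nat (fst \<alpha>)"] \<open>X \<noteq> {}\<close> by blast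
  obtain \<beta> where b: "\<beta> \<in> X" "\<And>\<alpha>. \<alpha> \<in> X \<Longrightarrow> nat (snd \<beta>) \<le> nat (snd \<alpha>)"
    using ex_has_least_nat[of "\<lambda>\<alpha>. \<alpha> \<in> X" _ "\<lambda>\<alpha>. nat (snd \<alpha>)"] \<open>X \<noteq> {}\<close> by blast
  have "inf \<alpha> \<beta> \<le> \<alpha>'" if "\<alpha>' \<in> X" for \<alpha>'
    using a(2)[OF that] b(2)[OF that] nonneg[OF that] nonneg[OF a(1)] nonneg[OF b(1)]
    by (auto simp: less_eq_prod_def inf_prod_def inf_min)
  then show ?thesis using inf[OF a(1) b(1)] by blast
qed

lemma Least_point:
  fixes X :: "point set"
  assumes "X \<noteq> {}" and "\<And>\<alpha>. \<alpha> \<in> X \<Longrightarrow> 0 \<le> \<alpha>"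
    and "\<And>\<alpha> \<beta>. \<alpha> \<in> X \<Longrightarrow> \<beta> \<in> X \<Longrightarrow> inf \<alpha> \<beta> \<in> X"
  shows "(LEAST \<alpha>. \<alpha> \<in> X) \<in> X" and "\<alpha> \<in> X \<Longrightarrow> (LEAST \<alpha>. \<alpha> \<in> X) \<le> \<alpha>"
proof -
  obtain \<mu> where m: "\<mu> \<in> X" "\<And>\<alpha>. \<alpha> \<in> X \<Longrightarrow> \<mu> \<le> \<alpha>"
    using ex_least_point[OF assms] by blast
  then have "(LEAST \<alpha>. \<alpha> \<in> X) = \<mu>" by (intro Least_equality) auto
  then show "(LEAST \<alpha>. \<alpha> \<in> X) \<in> X" and "\<alpha> \<in> X \<Longrightarrow> (LEAST \<alpha>. \<alpha> \<in> X) \<le> \<alpha>"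
    using m by auto
qed

locale local_good_semigroup =
  fixes S :: "point set"
  assumes good: "good_semigroup S" and local: "local_semigroup S"
begin

definition "e1 = fst (multiplicity_vector S)"
definition "e2 = snd (multiplicity_vector S)"
definition "c1 = fst (conductor S)"
definition "c2 = snd (conductor S)"

section \<open>The axioms in coordinates\<close>

lemma good_props:
  shows mem_nonneg: "S \<subseteq> {\<alpha>. 0 \<le> \<alpha>}" and zero_in: "0 \<in> S"
    and add_closed: "\<forall>\<alpha>\<in>S. \<forall>\<beta>\<in>S. \<alpha> + \<beta> \<in> S"
    and inf_closed: "\<forall>\<alpha>\<in>S. \<forall>\<beta>\<in>S. inf \<alpha> \<beta> \<in> S"
    and G2_fst: "\<forall>\<alpha>\<in>S. \<forall>\<beta>\<in>S. fst \<alpha> = fst \<beta> \<longrightarrow>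
        (\<exists>\<delta>\<in>S. fst \<delta> > fst \<alpha> \<and> snd \<delta> \<ge> min (snd \<alpha>) (snd \<beta>) \<and>
           (snd \<alpha> \<noteq> snd \<beta> \<longrightarrow> snd \<delta> = min (snd \<alpha>) (snd \<beta>)))"
    and G2_snd: "\<forall>\<alpha>\<in>S. \<forall>\<beta>\<in>S. snd \<alpha> = snd \<beta> \<longrightarrow>
        (\<exists>\<delta>\<in>S. snd \<delta> > snd \<alpha> \<and> fst \<delta> \<ge> min (fst \<alpha>) (fst \<beta>) \<and>
           (fst \<alpha> \<noteq> fst \<beta> \<longrightarrow> fst \<delta> = min (fst \<alpha>) (fst \<beta>)))"
    and ex_conductor: "\<exists>c\<in>S. \<forall>\<nu>\<ge>0. c + \<nu> \<in> S"
  using good unfolding good_semigroup_def by - (elim conjE, assumption)+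

lemma nonneg: "(x, y) \<in> S \<Longrightarrow> 0 \<le> x \<and> 0 \<le> y"
  using mem_nonneg by (auto simp: less_eq_prod_def)

lemma zero_mem: "(0, 0) \<in> S"
  using zero_in by (simp add: zero_prod_def)

lemma add_mem: "(x, y) \<in> S \<Longrightarrow> (x', y') \<in> S \<Longrightarrow> (x + x', y + y') \<in> S"
  using add_closed by fastforce

lemma inf_mem: "\<alpha> \<in> S \<Longrightarrow> \<beta> \<in> S \<Longrightarrow> inf \<alpha> \<beta> \<in> S"
  using inf_closed by blast

lemma corner_mem: "(x, b) \<in> S \<Longrightarrow> y \<le> b \<Longrightarrow> (a, y) \<in> S \<Longrightarrow> x \<le> a \<Longrightarrow> (x, y) \<in> S"
  using inf_mem[of "(x, b)" "(a, y)"] by (simp add: inf_prod_def inf_min)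

lemma ex_right: "(x, y) \<in> S \<Longrightarrow> (x, y') \<in> S \<Longrightarrow> y < y' \<Longrightarrow> \<exists>a>x. (a, y) \<in> S"
  using G2_fst[rule_format, of "(x, y)" "(x, y')"] by (auto simp: min_def)

lemma ex_above: "(x, y) \<in> S \<Longrightarrow> (x', y) \<in> S \<Longrightarrow> x < x' \<Longrightarrow> \<exists>b>y. (x, b) \<in> S"
  using G2_snd[rule_format, of "(x, y)" "(x', y)"] by (auto simp: min_def)

lemma conductor_props:
  shows conductor_mem: "c1 \<le> x \<Longrightarrow> c2 \<le> y \<Longrightarrow> (x, y) \<in> S"
    and conductor_le: "(\<And>x y. a \<le> x \<Longrightarrow> b \<le> y \<Longrightarrow> (x, y) \<in> S) \<Longrightarrow> c1 \<le> a \<and> c2 \<le> b"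
proof -
  define X where "X = {\<alpha>. \<forall>\<nu>\<ge>0. \<alpha> + \<nu> \<in> S}"
  have ne: "X \<noteq> {}" using ex_conductor unfolding X_def by blast
  have nn: "0 \<le> \<alpha>" if "\<alpha> \<in> X" for \<alpha>
  proof -
    have "\<alpha> + 0 \<in> S" using that unfolding X_def by blast
    then have "\<alpha> \<in> S" by simp
    then show ?thesis using mem_nonneg by blast
  qed
  have inf: "inf \<alpha> \<beta> \<in> X" if "\<alpha> \<in> X" "\<beta> \<in> X" for \<alpha> \<beta>
  proof -
    have "inf \<alpha> \<beta> + \<nu> = inf (\<alpha> + \<nu>) (\<beta> + \<nu>)" for \<nu>
      by (auto simp: inf_prod_def prod_eq_iff inf_min)
    then show ?thesis using that inf_mem unfolding X_def by simp
  qed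
  have eq: "conductor S = (LEAST \<alpha>. \<alpha> \<in> X)" by (simp add: conductor_def X_def)
  have least: "(LEAST \<alpha>. \<alpha> \<in> X) \<in> X" by (rule Least_point(1)[OF ne nn inf])
  have "(LEAST \<alpha>. \<alpha> \<in> X) \<le> \<alpha>" if "\<alpha> \<in> X" for \<alpha>
    by (rule Least_point(2)[OF ne nn inf that])
  with least have *: "conductor S \<in> X" "\<And>\<alpha>. \<alpha> \<in> X \<Longrightarrow> conductor S \<le> \<alpha>"
    by (simp_all add: eq)
  show "(x, y) \<in> S" if "c1 \<le> x" "c2 \<le> y"
  proof -
    have "conductor S + (x - c1, y - c2) \<in> S"
      using *(1) that unfolding X_def by (auto simp: less_eq_prod_def)
    moreover have "conductor S + (x - c1, y - c2) = (x, y)"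
      by (simp add: prod_eq_iff c1_def c2_def)
    ultimately show ?thesis by simp
  qed
  show "c1 \<le> a \<and> c2 \<le> b" if "\<And>x y. a \<le> x \<Longrightarrow> b \<le> y \<Longrightarrow> (x, y) \<in> S"
  proof -
    have "(a, b) \<in> X" using that unfolding X_def by (auto simp: less_eq_prod_def)
    from *(2)[OF this] show ?thesis by (simp add: c1_def c2_def less_eq_prod_def)
  qed
qed

text \<open>Locality makes both components of a nonzero element positive, so a meet of nonzero
  elements is again nonzero and the minimum of \<open>S - {0}\<close> exists.\<close>

lemma multiplicity_props:
  shows multiplicity_mem: "(e1, e2) \<in> S" and e1_pos: "0 < e1" and e2_pos: "0 < e2"
proof -
  have pos: "0 < x \<and> 0 < y" if "(x, y) \<in> S - {0}" for x y
    using that nonneg[of x y] local unfolding local_semigroup_def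
    by (auto simp: order_less_le zero_prod_def)
  have "(max 1 c1, max 1 c2) \<in> S - {0}"
    using conductor_mem[of "max 1 c1" "max 1 c2"] by (auto simp: zero_prod_def)
  then have ne: "S - {0} \<noteq> {}" by blast
  have nn: "0 \<le> \<alpha>" if "\<alpha> \<in> S - {0}" for \<alpha>
    using mem_nonneg that by blast
  have inf: "inf \<alpha> \<beta> \<in> S - {0}" if "\<alpha> \<in> S - {0}" "\<beta> \<in> S - {0}" for \<alpha> \<beta>
  proof -
    have "0 < fst \<alpha>" "0 < fst \<beta>"
      using pos[of "fst \<alpha>" "snd \<alpha>"] pos[of "fst \<beta>" "snd \<beta>"] that by auto
    then have "0 < fst (inf \<alpha> \<beta>)" by (simp add: inf_prod_def inf_min)
    then have "inf \<alpha> \<beta> \<noteq> 0" by (metis fst_zero order_less_irrefl)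
    then show ?thesis using that inf_mem by auto
  qed
  have "(LEAST \<alpha>. \<alpha> \<in> S - {0}) \<in> S - {0}" by (rule Least_point(1)[OF ne nn inf])
  then have "(e1, e2) \<in> S - {0}" unfolding multiplicity_vector_def e1_def e2_def by simp
  then show "(e1, e2) \<in> S" "0 < e1" "0 < e2" using pos[of e1 e2] by auto
qed

lemma mem_shift: "(x - e1, y - e2) \<in> S \<Longrightarrow> (x, y) \<in> S"
  using add_mem[OF _ multiplicity_mem, of "x - e1" "y - e2"] by simp

lemma Apery_iff: "(x, y) \<in> Apery S \<longleftrightarrow> (x, y) \<in> S \<and> (x - e1, y - e2) \<notin> S"
proof -
  have "(x, y) - multiplicity_vector S = (x - e1, y - e2)"
    by (simp add: e1_def e2_def prod_eq_iff)
  then show ?thesis by (simp add: Apery_def)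
qed

text \<open>By (G2) against points of column \<open>c1\<close>, an element of column
  \<open>c1 - 1\<close> at height at least \<open>c2\<close> could be pushed up without bound. Meets
  with the points \<open>(c1, y)\<close> would then fill the column from height \<open>c2\<close>
  on, and the conductor would have a smaller first component.\<close>

lemma no_mem_left_of_conductor: "c2 \<le> b \<Longrightarrow> (c1 - 1, b) \<notin> S"
proof
  assume b: "c2 \<le> b" "(c1 - 1, b) \<in> S"
  have ex: "\<exists>b'\<ge>y. (c1 - 1, b') \<in> S" if "b \<le> y" for y
    using that
  proof (induction y rule: int_ge_induct)
    case base
    then show ?case using b by auto
  next
    case (step y)
    then obtain b' where b': "y \<le> b'" "(c1 - 1, b') \<in> S" by auto
    moreover have "(c1, b') \<in> S" using b(1) b'(1) step.hyps by (intro conductor_mem) auto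
    ultimately obtain b'' where "b' < b''" "(c1 - 1, b'') \<in> S"
      using ex_above[of "c1 - 1" b' c1] by auto
    then show ?case using b'(1) by (intro exI[of _ b'']) auto
  qed
  have "(x, y) \<in> S" if "c1 - 1 \<le> x" "c2 \<le> y" for x y
  proof (cases "x = c1 - 1")
    case True
    obtain b' where "max b y \<le> b'" "(c1 - 1, b') \<in> S" using ex[of "max b y"] by auto
    then show ?thesis
      using corner_mem[of "c1 - 1" b' y c1] conductor_mem[of c1 y] that True by auto
  qed (use that conductor_mem in auto)
  then show False using conductor_le[of "c1 - 1" c2] by simp
qed

lemma no_mem_below_conductor: "c1 \<le> a \<Longrightarrow> (a, c2 - 1) \<notin> S"
proof
  assume a: "c1 \<le> a" "(a, c2 - 1) \<in> S"
  have ex: "\<exists>a'\<ge>x. (a', c2 - 1) \<in> S" if "a \<le> x" for x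
    using that
  proof (induction x rule: int_ge_induct)
    case base
    then show ?case using a by auto
  next
    case (step x)
    then obtain a' where a': "x \<le> a'" "(a', c2 - 1) \<in> S" by auto
    moreover have "(a', c2) \<in> S" using a(1) a'(1) step.hyps by (intro conductor_mem) auto
    ultimately obtain a'' where "a' < a''" "(a'', c2 - 1) \<in> S"
      using ex_right[of a' "c2 - 1" c2] by auto
    then show ?case using a'(1) by (intro exI[of _ a'']) auto
  qed
  have "(x, y) \<in> S" if "c1 \<le> x" "c2 - 1 \<le> y" for x y
  proof (cases "y = c2 - 1")
    case True
    obtain a' where "max a x \<le> a'" "(a', c2 - 1) \<in> S" using ex[of "max a x"] by auto
    then show ?thesis
      using corner_mem[of x c2 "c2 - 1" a'] conductor_mem[of x c2] that True by auto
  qed (use that conductor_mem in auto)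
  then show False using conductor_le[of c1 "c2 - 1"] by simp
qed

section \<open>Relative length\<close>

text \<open>The unit losses of the filtration: \<open>has_above x y\<close> says that the step from
  \<open>(x, y)\<close> to \<open>(x + 1, y)\<close> costs length one, and
  \<open>has_right x y\<close> does so for the step to \<open>(x, y + 1)\<close>.\<close>

definition has_above :: "int \<Rightarrow> int \<Rightarrow> bool" where
  "has_above x y \<longleftrightarrow> (\<exists>b\<ge>y. (x, b) \<in> S)"

definition has_right :: "int \<Rightarrow> int \<Rightarrow> bool" where
  "has_right x y \<longleftrightarrow> (\<exists>a\<ge>x. (a, y) \<in> S)"

text \<open>The nontrivial direction is (G1): \<open>(x, y)\<close> is the meet of an element above
  it in its column and an element to its right in its row.\<close>

lemma mem_iff_has: "(x, y) \<in> S \<longleftrightarrow> has_above x y \<and> has_right x y"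
  using corner_mem unfolding has_above_def has_right_def by blast

lemma has_above_rec: "has_above x y \<longleftrightarrow> (x, y) \<in> S \<or> has_above x (y + 1)"
  unfolding has_above_def by (metis add1_zle_eq order_le_less order_refl)

lemma has_right_rec: "has_right x y \<longleftrightarrow> (x, y) \<in> S \<or> has_right (x + 1) y"
  unfolding has_right_def by (metis add1_zle_eq order_le_less order_refl)

lemma has_above_iff_has_right:
  assumes "(x, y) \<in> S"
  shows "has_above x (y + 1) \<longleftrightarrow> has_right (x + 1) y"
proof
  assume "has_above x (y + 1)"
  then obtain b where "y + 1 \<le> b" "(x, b) \<in> S" by (auto simp: has_above_def)
  then obtain a where "x < a" "(a, y) \<in> S" using ex_right[OF assms, of b] by auto
  then show "has_right (x + 1) y" unfolding has_right_def by (intro exI[of _ a]) simp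
next
  assume "has_right (x + 1) y"
  then obtain a where "x + 1 \<le> a" "(a, y) \<in> S" by (auto simp: has_right_def)
  then obtain b where "y < b" "(x, b) \<in> S" using ex_above[OF assms, of a] by auto
  then show "has_above x (y + 1)" unfolding has_above_def by (intro exI[of _ b]) simp
qed

text \<open>Path independence around a unit square. If the corner lies in \<open>S\<close>, this is
  (G2); if not, neither predicate changes when the corner is skipped.\<close>

lemma square:
  "of_bool (has_above x y) + of_bool (has_right (x + 1) y) =
   (of_bool (has_right x y) + of_bool (has_above x (y + 1)) :: int)"
proof (cases "(x, y) \<in> S")
  case True
  then have "has_above x y" "has_right x y" by (simp_all add: mem_iff_has)
  then show ?thesis using has_above_iff_has_right[OF True] by simp
next
  case False
  then have "has_above x y = has_above x (y + 1)" "has_right x y = has_right (x + 1) y"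
    using has_above_rec[of x y] has_right_rec[of x y] by blast+
  then show ?thesis by simp
qed

text \<open>The ideal \<open>e + S\<close> is contained in \<open>S\<close>, so it loses length only
  at steps where \<open>S\<close> does; this makes \<open>rlen\<close> monotone.\<close>

lemma has_above_shift: "has_above (x - e1) (y - e2) \<Longrightarrow> has_above x y"
proof -
  assume "has_above (x - e1) (y - e2)"
  then obtain b where "y - e2 \<le> b" "(x - e1, b) \<in> S" by (auto simp: has_above_def)
  then show ?thesis using mem_shift[of x "b + e2"] unfolding has_above_def
    by (intro exI[of _ "b + e2"]) auto
qed

lemma has_right_shift: "has_right (x - e1) (y - e2) \<Longrightarrow> has_right x y"
proof -
  assume "has_right (x - e1) (y - e2)"
  then obtain a where "x - e1 \<le> a" "(a, y - e2) \<in> S" by (auto simp: has_right_def)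
  then show ?thesis using mem_shift[of "a + e1" y] unfolding has_right_def
    by (intro exI[of _ "a + e1"]) auto
qed

lemma has_above_conductor: "c1 \<le> x \<Longrightarrow> has_above x y"
  unfolding has_above_def using conductor_mem[of x "max y c2"] by (intro exI[of _ "max y c2"]) auto

lemma has_right_conductor: "c2 \<le> y \<Longrightarrow> has_right x y"
  unfolding has_right_def using conductor_mem[of "max x c1" y] by (intro exI[of _ "max x c1"]) auto

text \<open>The length lost along the path from the origin that first moves right and then up.\<close>

definition len :: "int \<Rightarrow> int \<Rightarrow> int" where
  "len x y = int (card {a. a < x \<and> (\<exists>b. (a, b) \<in> S)}) + int (card {b. b < y \<and> has_right x b})"

lemma card_has_right_nonpos: "y \<le> 0 \<Longrightarrow> card {b. b < y \<and> has_right x b} = 0"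
  by (subst card_eq_0_iff) (auto simp: has_right_def dest!: nonneg)

lemma len_nonpos: "x \<le> 0 \<Longrightarrow> y \<le> 0 \<Longrightarrow> len x y = 0"
proof -
  assume xy: "x \<le> 0" "y \<le> 0"
  have "card {a. a < x \<and> (\<exists>b. (a, b) \<in> S)} = 0"
    using xy by (subst card_eq_0_iff) (auto dest!: nonneg)
  with xy show ?thesis unfolding len_def by (simp only: card_has_right_nonpos of_nat_0 add_0)
qed

lemma card_less_plus1:
  fixes P :: "int \<Rightarrow> bool"
  assumes "\<And>a. P a \<Longrightarrow> 0 \<le> a"
  shows "int (card {a. a < x + 1 \<and> P a}) = int (card {a. a < x \<and> P a}) + of_bool (P x)"
proof -
  \<comment> \<open>Without a lower bound for \<open>P\<close> the set could be infinite, and its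
    \<open>card\<close> would be 0.\<close>
  have "{a. a < x \<and> P a} \<subseteq> {0..<x}" using assms by auto
  then have "finite {a. a < x \<and> P a}" by (rule finite_subset) simp
  moreover have "{a. a < x + 1 \<and> P a} = (if P x then insert x {a. a < x \<and> P a} else {a. a < x \<and> P a})"
    by (auto simp: order_less_le)
  ultimately show ?thesis by simp
qed

lemma len_up: "len x (y + 1) = len x y + of_bool (has_right x y)"
proof -
  have "has_right x b \<Longrightarrow> 0 \<le> b" for b by (auto simp: has_right_def dest!: nonneg)
  from card_less_plus1[of "has_right x", OF this] show ?thesis unfolding len_def by simp
qed

text \<open>\<open>len\<close> follows one fixed path, so path independence enters here: at height
  at most 0 the vertical part of the path contributes nothing, and \<open>square\<close> carries the
  formula up row by row.\<close>

lemma len_right: "len (x + 1) y = len x y + of_bool (has_above x y)"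
proof -
  have nonpos: "len (x + 1) y = len x y + of_bool (has_above x y)" if "y \<le> 0" for y
  proof -
    have "(\<exists>b. (x, b) \<in> S) \<longleftrightarrow> has_above x y"
      using that unfolding has_above_def by (meson nonneg order_trans)
    moreover have "int (card {a. a < x + 1 \<and> (\<exists>b. (a, b) \<in> S)}) =
        int (card {a. a < x \<and> (\<exists>b. (a, b) \<in> S)}) + of_bool (\<exists>b. (x, b) \<in> S)"
      by (rule card_less_plus1) (auto dest!: nonneg)
    ultimately show ?thesis using that unfolding len_def by (simp only: card_has_right_nonpos of_nat_0 add_0_right)
  qed
  show ?thesis
  proof (cases "y \<le> 0")
    case False
    then have "0 \<le> y" by simp
    then show ?thesis
    proof (induction y rule: int_ge_induct)
      case base
      show ?case by (rule nonpos) simp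
    next
      case (step y)
      then show ?case using square[of x y] len_up[of x y] len_up[of "x + 1" y] by simp
    qed
  qed (rule nonpos)
qed

text \<open>The second term is the length lost by the ideal \<open>e + S\<close> up to
  \<open>(x, y)\<close>: its steps are those of \<open>S\<close> translated by
  \<open>(e1, e2)\<close>.\<close>

definition rlen :: "int \<Rightarrow> int \<Rightarrow> int" where
  "rlen x y = len x y - len (x - e1) (y - e2)"

lemma rlen_right:
  "rlen (x + 1) y = rlen x y + of_bool (has_above x y) - of_bool (has_above (x - e1) (y - e2))"
  using len_right[of x y] len_right[of "x - e1" "y - e2"] unfolding rlen_def
  by (simp add: algebra_simps)

lemma rlen_up:
  "rlen x (y + 1) = rlen x y + of_bool (has_right x y) - of_bool (has_right (x - e1) (y - e2))"
  using len_up[of x y] len_up[of "x - e1" "y - e2"] unfolding rlen_def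
  by (simp add: algebra_simps)

lemma rlen_right_ge: "rlen x y \<le> rlen (x + 1) y"
  using rlen_right[of x y] has_above_shift[of x y] by auto

lemma rlen_up_ge: "rlen x y \<le> rlen x (y + 1)"
  using rlen_up[of x y] has_right_shift[of x y] by auto

lemma rlen_mono: "x \<le> x' \<Longrightarrow> y \<le> y' \<Longrightarrow> rlen x y \<le> rlen x' y'"
proof -
  assume "x \<le> x'" "y \<le> y'"
  from \<open>x \<le> x'\<close> have "rlen x y \<le> rlen x' y"
    by (induction x' rule: int_ge_induct) (use rlen_right_ge order_trans in blast)+
  also from \<open>y \<le> y'\<close> have "rlen x' y \<le> rlen x' y'"
    by (induction y' rule: int_ge_induct) (use rlen_up_ge order_trans in blast)+
  finally show ?thesis .
qed

lemma rlen_zero: "rlen 0 0 = 0"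
  using e1_pos e2_pos len_nonpos by (simp add: rlen_def)

text \<open>The value at the conductor of \<open>e + S\<close>. From there on both \<open>S\<close>
  and \<open>e + S\<close> lose length at every step, so \<open>rlen\<close> stays constant;
  \<open>num_levels_eq\<close> identifies this value with the number of levels.\<close>

definition max_rlen :: int where
  "max_rlen = rlen (c1 + e1) (c2 + e2)"

lemma rlen_conductor: "c1 + e1 \<le> x \<Longrightarrow> c2 + e2 \<le> y \<Longrightarrow> rlen x y = max_rlen"
proof -
  assume "c1 + e1 \<le> x" "c2 + e2 \<le> y"
  from \<open>c1 + e1 \<le> x\<close> have "rlen x (c2 + e2) = max_rlen"
  proof (induction x rule: int_ge_induct)
    case (step x)
    then show ?case
      using rlen_right[of x "c2 + e2"] has_above_conductor[of x] has_above_conductor[of "x - e1"]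
        e1_pos by simp
  qed (simp add: max_rlen_def)
  with \<open>c2 + e2 \<le> y\<close> show ?thesis
  proof (induction y rule: int_ge_induct)
    case (step y)
    then show ?case
      using rlen_up[of x y] has_right_conductor[of y] has_right_conductor[of "y - e2"]
        e2_pos by simp
  qed
qed

lemma rlen_le_max: "rlen x y \<le> max_rlen"
  using rlen_mono[of x "max x (c1 + e1)" y "max y (c2 + e2)"]
    rlen_conductor[of "max x (c1 + e1)" "max y (c2 + e2)"] by simp

section \<open>Levels\<close>

text \<open>At a point of \<open>S\<close> both steps cost \<open>S\<close> length one. As the point
  is not in \<open>e + S\<close>, \<open>mem_iff_has\<close> shows that one of the steps costs
  \<open>e + S\<close> nothing.\<close>

lemma Apery_cases:
  assumes "(x, y) \<in> Apery S"
  shows "rlen (x + 1) y = rlen x y + 1 \<or> rlen x (y + 1) = rlen x y + 1"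
proof -
  have "(x, y) \<in> S" "(x - e1, y - e2) \<notin> S" using assms by (auto simp: Apery_iff)
  then show ?thesis
    using mem_iff_has[of x y] mem_iff_has[of "x - e1" "y - e2"] rlen_right[of x y] rlen_up[of x y]
    by auto
qed

lemma rlen_strict_mono:
  assumes "(x, y) \<in> Apery S" "x < x'" "y < y'"
  shows "rlen x y < rlen x' y'"
  using Apery_cases[OF assms(1)] rlen_mono[of "x + 1" x' y y'] rlen_mono[of x x' "y + 1" y'] assms(2,3)
  by auto

lemma rlen_less_max: "(x, y) \<in> Apery S \<Longrightarrow> rlen x y < max_rlen"
  using rlen_strict_mono[of x y "x + 1" "y + 1"] rlen_le_max[of "x + 1" "y + 1"] by auto

text \<open>
  As long as the current point is not in the Apery set, some step to the right or upwards leaves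
  the relative length unchanged.
\<close>

lemma ex_Apery_rlen:
  assumes "rlen x y < max_rlen"
  shows "\<exists>a\<ge>x. \<exists>b\<ge>y. (a, b) \<in> Apery S \<and> rlen a b = rlen x y"
  using assms
proof (induction "nat (c1 + e1 - x) + nat (c2 + e2 - y)" arbitrary: x y rule: less_induct)
  case less
  \<comment> \<open>Some step still decreases the measure; in the cases below the free step has to
    be one of these.\<close>
  have out: "x < c1 + e1 \<or> y < c2 + e2" using less.prems rlen_conductor[of x y] by force
  have right: ?case if "x < c1 + e1" "rlen (x + 1) y = rlen x y"
  proof -
    have "\<exists>a\<ge>x + 1. \<exists>b\<ge>y. (a, b) \<in> Apery S \<and> rlen a b = rlen (x + 1) y"
      using less.prems that by (intro less.hyps) auto
    then show ?thesis using that(2) by (metis order_less_imp_le less_add_one order_trans)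
  qed
  have up: ?case if "y < c2 + e2" "rlen x (y + 1) = rlen x y"
  proof -
    have "\<exists>a\<ge>x. \<exists>b\<ge>y + 1. (a, b) \<in> Apery S \<and> rlen a b = rlen x (y + 1)"
      using less.prems that by (intro less.hyps) auto
    then show ?thesis using that(2) by (metis order_less_imp_le less_add_one order_trans)
  qed
  consider "(x, y) \<in> Apery S" | "(x - e1, y - e2) \<in> S" | "(x, y) \<notin> S"
    by (auto simp: Apery_iff)
  then show ?case
  proof cases
    case 1
    then show ?thesis by blast
  next
    case 2
    then show ?thesis
      using out right up mem_iff_has[of "x - e1" "y - e2"] mem_iff_has[of x y] mem_shift[of x y]
        rlen_right[of x y] rlen_up[of x y] by auto
  next
    case 3
    show ?thesis
    proof (cases "has_above x y")
      case True
      then have "\<not> has_right x y" using 3 mem_iff_has by blast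
      moreover from this have "y < c2 + e2"
        using has_right_conductor[of y x] e2_pos by linarith
      ultimately show ?thesis using up rlen_up[of x y] has_right_shift[of x y] by auto
    next
      case False
      then have "x < c1 + e1" using has_above_conductor[of x y] e1_pos by linarith
      then show ?thesis using right False rlen_right[of x y] has_above_shift[of x y] by auto
    qed
  qed
qed

text \<open>Walk right to the first element of \<open>S\<close> in the row. Before it
  \<open>has_right\<close> holds without membership, so \<open>has_above\<close> fails and each step
  leaves \<open>rlen\<close> unchanged.\<close>

lemma ex_right_rlen:
  assumes "has_right x y"
  shows "\<exists>a\<ge>x. (a, y) \<in> S \<and> rlen a y = rlen x y"
proof -
  obtain z where "x \<le> z" "(z, y) \<in> S" using assms by (auto simp: has_right_def)
  then show ?thesis
  proof (induction x rule: int_le_induct)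
    case (step x)
    show ?case
    proof (cases "(x - 1, y) \<in> S")
      case False
      have "has_right (x - 1) y" using step by (auto simp: has_right_def intro!: exI[of _ z])
      then have "\<not> has_above (x - 1) y" using False mem_iff_has by blast
      then have "rlen x y = rlen (x - 1) y"
        using rlen_right[of "x - 1" y] has_above_shift[of "x - 1" y] by auto
      moreover obtain a where "x \<le> a" "(a, y) \<in> S" "rlen a y = rlen x y" using step by blast
      ultimately show ?thesis by (intro exI[of _ a]) auto
    qed auto
  qed auto
qed

lemma ex_above_rlen:
  assumes "has_above x y"
  shows "\<exists>b\<ge>y. (x, b) \<in> S \<and> rlen x b = rlen x y"
proof -
  obtain z where "y \<le> z" "(x, z) \<in> S" using assms by (auto simp: has_above_def)
  then show ?thesis
  proof (induction y rule: int_le_induct)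
    case (step y)
    show ?case
    proof (cases "(x, y - 1) \<in> S")
      case False
      have "has_above x (y - 1)" using step by (auto simp: has_above_def intro!: exI[of _ z])
      then have "\<not> has_right x (y - 1)" using False mem_iff_has by blast
      then have "rlen x y = rlen x (y - 1)"
        using rlen_up[of x "y - 1"] has_right_shift[of x "y - 1"] by auto
      moreover obtain b where "y \<le> b" "(x, b) \<in> S" "rlen x b = rlen x y" using step by blast
      ultimately show ?thesis by (intro exI[of _ b]) auto
    qed auto
  qed auto
qed

text \<open>Below the greatest admissible value, an Apery element is either not maximal or the meet
  of two others. The second case arises when both unit steps raise \<open>rlen\<close> and
  \<open>S\<close> continues beyond the point in its row and column while \<open>e + S\<close> does
  not; the first elements met there are the two others.\<close>

lemma Apery_successor:
  assumes A: "(x, y) \<in> Apery S" and less: "rlen x y + 1 < max_rlen"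
  shows "(\<exists>a>x. \<exists>b>y. (a, b) \<in> Apery S \<and> rlen a b = rlen x y + 1) \<or>
    (\<exists>b>y. (x, b) \<in> Apery S \<and> rlen x b = rlen x y + 1) \<and>
    (\<exists>a>x. (a, y) \<in> Apery S \<and> rlen a y = rlen x y + 1)"
proof -
  have S: "(x, y) \<in> S" and E: "(x - e1, y - e2) \<notin> S" using A by (auto simp: Apery_iff)
  have hS: "has_above x y" "has_right x y" using S mem_iff_has by auto
  have sE: "has_right (x + 1 - e1) (y - e2) \<longleftrightarrow> has_right (x - e1) (y - e2)"
    using has_right_rec[of "x - e1" "y - e2"] E by (simp add: algebra_simps)
  show ?thesis
  proof (cases "has_above x (y + 1) \<and> \<not> has_above (x - e1) (y - e2) \<and> \<not> has_right (x - e1) (y - e2)")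
    case True
    then have R: "has_right (x + 1) y" using has_above_iff_has_right[OF S] by blast
    obtain b where b: "y + 1 \<le> b" "(x, b) \<in> S" "rlen x b = rlen x (y + 1)"
      using True ex_above_rlen by blast
    obtain a where a: "x + 1 \<le> a" "(a, y) \<in> S" "rlen a y = rlen (x + 1) y"
      using R ex_right_rlen by blast
    have "(x - e1, b - e2) \<notin> S"
      using True b(1) by (auto simp: has_above_def dest!: spec[of _ "b - e2"])
    moreover have "(a - e1, y - e2) \<notin> S"
      using True a(1) by (auto simp: has_right_def dest!: spec[of _ "a - e1"])
    moreover have "rlen x (y + 1) = rlen x y + 1" "rlen (x + 1) y = rlen x y + 1"
      using True hS rlen_up[of x y] rlen_right[of x y] by auto
    ultimately have "b > y \<and> (x, b) \<in> Apery S \<and> rlen x b = rlen x y + 1"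
      and "a > x \<and> (a, y) \<in> Apery S \<and> rlen a y = rlen x y + 1"
      using a b by (auto simp: Apery_iff)
    then show ?thesis by blast
  next
    case False
    \<comment> \<open>On the path through \<open>(x + 1, y)\<close> at least one of the two unit
      steps now leaves \<open>rlen\<close> unchanged.\<close>
    have "rlen (x + 1) (y + 1) \<le> rlen x y + 1"
      using False hS E rlen_right[of x y] rlen_up[of "x + 1" y] sE mem_iff_has[of "x - e1" "y - e2"]
        has_above_iff_has_right[OF S] by (auto split: if_splits)
    moreover have "rlen x y < rlen (x + 1) (y + 1)" using rlen_strict_mono[OF A] by simp
    ultimately have eq: "rlen (x + 1) (y + 1) = rlen x y + 1" by simp
    then show ?thesis using ex_Apery_rlen[of "x + 1" "y + 1"] less by force
  qed
qed

text \<open>Elements of value \<open>k\<close> are maximal by \<open>rlen_strict_mono\<close>, and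
  they are no meets because one of the two unit steps already exceeds \<open>k\<close>. Elements of
  smaller value are discarded by \<open>Apery_successor\<close>.\<close>

lemma greatest_level:
  assumes "k < max_rlen"
  defines "X \<equiv> {(x, y). (x, y) \<in> Apery S \<and> rlen x y \<le> k}"
  shows "maximal_elements X - meets_of_others (maximal_elements X)
    = {(x, y). (x, y) \<in> Apery S \<and> rlen x y = k}" (is "?L = ?R")
proof (intro subset_antisym subsetI)
  fix \<alpha> assume "\<alpha> \<in> ?R"
  then obtain x y where \<alpha>: "\<alpha> = (x, y)" and A: "(x, y) \<in> Apery S" and k: "rlen x y = k" by auto
  have "\<alpha> \<in> maximal_elements X"
    using A k rlen_strict_mono[OF A] unfolding \<alpha> X_def maximal_elements_def
    by (fastforce simp: below_eq_def strictly_below_def)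
  moreover have "\<alpha> \<notin> meets_of_others (maximal_elements X)"
  proof
    assume "\<alpha> \<in> meets_of_others (maximal_elements X)"
    then obtain \<beta>1 \<beta>2 where "\<beta>1 \<in> X" "\<beta>2 \<in> X" "\<beta>1 \<noteq> \<alpha>" "\<beta>2 \<noteq> \<alpha>" "\<alpha> = inf \<beta>1 \<beta>2"
      unfolding meets_of_others_def maximal_elements_def by blast
    \<comment> \<open>A meet different from both points takes one component from each, so one point
      lies in its row and the other in its column.\<close>
    then obtain a b where "(a, y) \<in> X" "a > x" "(x, b) \<in> X" "b > y"
      unfolding \<alpha> by (cases \<beta>1; cases \<beta>2) (auto simp: inf_prod_def inf_min min_def split: if_splits)
    then show False
      using Apery_cases[OF A] k rlen_mono[of "x + 1" a y y] rlen_mono[of x x "y + 1" b]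
      unfolding X_def by auto
  qed
  ultimately show "\<alpha> \<in> ?L" by blast
next
  fix \<alpha> assume L: "\<alpha> \<in> ?L"
  obtain x y where \<alpha>: "\<alpha> = (x, y)" by fastforce
  have max: "(x, y) \<in> maximal_elements X" and "(x, y) \<in> X"
    using L unfolding \<alpha> maximal_elements_def by auto
  then have A: "(x, y) \<in> Apery S" and le: "rlen x y \<le> k" unfolding X_def by auto
  have none: "(a, b) \<notin> X" if "x < a" "y < b" for a b
    using max that unfolding maximal_elements_def by (fastforce simp: below_eq_def strictly_below_def)
  have "rlen x y = k"
  proof (rule ccontr)
    assume "rlen x y \<noteq> k"
    with le have less: "rlen x y < k" by simp
    then obtain a b where b: "b > y" "(x, b) \<in> X" and a: "a > x" "(a, y) \<in> X"
      using Apery_successor[OF A] assms(1) none unfolding X_def by force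
    have "(x, b) \<in> maximal_elements X"
      using b none unfolding maximal_elements_def by (force simp: below_eq_def strictly_below_def)
    moreover have "(a, y) \<in> maximal_elements X"
      using a none unfolding maximal_elements_def by (force simp: below_eq_def strictly_below_def)
    moreover have "(x, y) = inf (x, b) (a, y)" using a b by (simp add: inf_prod_def inf_min)
    ultimately have "\<alpha> \<in> meets_of_others (maximal_elements X)"
      using max a b unfolding \<alpha> meets_of_others_def by blast
    then show False using L by blast
  qed
  then show "\<alpha> \<in> ?R" using A \<alpha> by simp
qed

section \<open>Levels as fibres of \<open>rlen\<close> on the Apery set\<close>

lemma top_level_eq:
  "1 \<le> i \<Longrightarrow> top_level S i = {(x, y). (x, y) \<in> Apery S \<and> rlen x y = max_rlen - int i}"
proof (induction i rule: less_induct)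
  case (less i)
  have "Apery S - (\<Union>j\<in>{1..<i}. top_level S j) = {(x, y). (x, y) \<in> Apery S \<and> rlen x y \<le> max_rlen - int i}"
    (is "?X = ?Y")
  proof -
    \<comment> \<open>The value \<open>max_rlen\<close> itself, which would need
      \<open>j = 0\<close>, is not attained on the Apery set.\<close>
    have "(\<exists>j\<in>{1..<i}. rlen x y = max_rlen - int j) \<longleftrightarrow> max_rlen - int i < rlen x y"
      if "(x, y) \<in> Apery S" for x y
      using rlen_less_max[OF that] by (auto intro!: bexI[of _ "nat (max_rlen - rlen x y)"])
    moreover have "(\<Union>j\<in>{1..<i}. top_level S j) =
        (\<Union>j\<in>{1..<i}. {(x, y). (x, y) \<in> Apery S \<and> rlen x y = max_rlen - int j})"
      using less.IH by auto
    ultimately show ?thesis by fastforce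
  qed
  then show ?case
    using greatest_level[of "max_rlen - int i"] less.prems by (subst top_level.simps) (simp add: Let_def)
qed

lemma zero_Apery: "(0, 0) \<in> Apery S"
  using zero_mem nonneg[of "0 - e1" "0 - e2"] e1_pos by (auto simp: Apery_iff)

lemma rlen_Apery_nonneg: "(x, y) \<in> Apery S \<Longrightarrow> 0 \<le> rlen x y"
  using nonneg[of x y] rlen_mono[of 0 x 0 y] rlen_zero by (simp add: Apery_iff)

text \<open>No smaller number of levels suffices because \<open>(0, 0)\<close> is an Apery element
  with \<open>rlen\<close> 0 and so lies only in the level of index \<open>max_rlen\<close>.\<close>

lemma num_levels_eq: "int (num_levels S) = max_rlen"
proof -
  have pos: "0 < max_rlen" using rlen_less_max[OF zero_Apery] rlen_zero by simp
  have "num_levels S = nat max_rlen"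
    unfolding num_levels_def
  proof (rule Least_equality)
    have "\<exists>i\<in>{1..nat max_rlen}. (x, y) \<in> top_level S i" if "(x, y) \<in> Apery S" for x y
      using rlen_less_max[OF that] rlen_Apery_nonneg[OF that] that
      by (intro bexI[of _ "nat (max_rlen - rlen x y)"]) (auto simp: top_level_eq)
    then show "Apery S = (\<Union>i\<in>{1..nat max_rlen}. top_level S i)"
      by (fastforce simp: top_level_eq)
  next
    fix n assume "Apery S = (\<Union>i\<in>{1..n}. top_level S i)"
    then obtain i where "1 \<le> i" "i \<le> n" "(0, 0) \<in> top_level S i" using zero_Apery by auto
    then show "nat max_rlen \<le> n" using rlen_zero by (simp add: top_level_eq)
  qed
  then show ?thesis using pos by simp
qed

lemma level_eq:
  "1 \<le> i \<Longrightarrow> i \<le> num_levels S \<Longrightarrow>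
    level S i = {(x, y). (x, y) \<in> Apery S \<and> rlen x y = int i - 1}"
  using num_levels_eq unfolding level_def by (subst top_level_eq) (auto simp: of_nat_diff)

lemma Apery_eq_levels: "Apery S = (\<Union>i\<in>{1..num_levels S}. level S i)"
proof -
  have "\<exists>i\<in>{1..num_levels S}. (x, y) \<in> level S i" if "(x, y) \<in> Apery S" for x y
    using rlen_less_max[OF that] rlen_Apery_nonneg[OF that] that num_levels_eq
    by (intro bexI[of _ "nat (rlen x y + 1)"]) (auto simp: level_eq)
  then show ?thesis by (fastforce simp: level_eq)
qed

section \<open>Reflection\<close>

lemma Delta_iff:
  "(a, b) \<in> Delta S (x, y) \<longleftrightarrow> (a, b) \<in> S \<and> (a = x \<and> y < b \<or> b = y \<and> x < a)"
  by (auto simp: Delta_def)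

lemma Delta_empty_iff: "Delta S (x, y) = {} \<longleftrightarrow> \<not> has_above x (y + 1) \<and> \<not> has_right (x + 1) y"
proof -
  have "Delta S (x, y) = {} \<longleftrightarrow> (\<forall>a b. (a, b) \<notin> Delta S (x, y))" by auto
  then show ?thesis
    by (simp only: Delta_iff has_above_def has_right_def add1_zle_eq) blast
qed

lemma gamma_minus: "gamma S - (x, y) = (c1 - 1 - x, c2 - 1 - y)"
  by (simp add: gamma_def c1_def c2_def prod_eq_iff)

lemma reflect_eq: "reflect S (x, y) = (c1 - 1 + e1 - x, c2 - 1 + e2 - y)"
  by (simp add: reflect_def gamma_def c1_def c2_def e1_def e2_def prod_eq_iff)

text \<open>The sum of two witnesses would lie in column \<open>c1 - 1\<close> at height at least
  \<open>c2\<close>, where \<open>S\<close> has no elements.\<close>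

lemma not_has_above_both: "has_above x y \<Longrightarrow> \<not> has_above (c1 - 1 - x) (c2 - y)"
proof
  assume "has_above x y" "has_above (c1 - 1 - x) (c2 - y)"
  then obtain b b' where "y \<le> b" "(x, b) \<in> S" "c2 - y \<le> b'" "(c1 - 1 - x, b') \<in> S"
    by (auto simp: has_above_def)
  then show False using add_mem[of x b "c1 - 1 - x" b'] no_mem_left_of_conductor[of "b + b'"] by simp
qed

lemma not_has_right_both: "has_right x y \<Longrightarrow> \<not> has_right (c1 - x) (c2 - 1 - y)"
proof
  assume "has_right x y" "has_right (c1 - x) (c2 - 1 - y)"
  then obtain a a' where "x \<le> a" "(a, y) \<in> S" "c1 - x \<le> a'" "(a', c2 - 1 - y) \<in> S"
    by (auto simp: has_right_def)
  then show False using add_mem[of a y a' "c2 - 1 - y"] no_mem_below_conductor[of "a + a'"] by simp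
qed

text \<open>The half of symmetry that holds in every good semigroup.\<close>

lemma Delta_gamma_minus_mem:
  assumes "(x, y) \<in> S"
  shows "Delta S (c1 - 1 - x, c2 - 1 - y) = {}"
  using assms not_has_above_both[of x y] not_has_right_both[of x y] mem_iff_has[of x y]
  by (simp add: Delta_empty_iff)

text \<open>Both sides say that the sum of the two points agrees with
  \<open>gamma S + multiplicity_vector S\<close> in one component and exceeds it in the
  other.\<close>

lemma Delta_reflect_sym:
  assumes "(x, y) \<in> S" "(a, b) \<in> S"
  shows "(a, b) \<in> Delta S (reflect S (x, y)) \<longleftrightarrow> (x, y) \<in> Delta S (reflect S (a, b))"
  using assms unfolding reflect_eq Delta_iff by auto

text \<open>Subtracting \<open>(e1, e2)\<close> from an element outside the Apery set would give an
  element of the empty set in \<open>Delta_gamma_minus_mem\<close>.\<close>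

lemma Delta_reflect_subset_Apery:
  assumes "(x, y) \<in> S"
  shows "Delta S (reflect S (x, y)) \<subseteq> Apery S"
proof
  fix \<beta> assume "\<beta> \<in> Delta S (reflect S (x, y))"
  then obtain a b where "\<beta> = (a, b)" and ab: "(a, b) \<in> Delta S (reflect S (x, y))" by (cases \<beta>) auto
  moreover have "(a - e1, b - e2) \<notin> S"
  proof
    assume "(a - e1, b - e2) \<in> S"
    then have "(a - e1, b - e2) \<in> Delta S (c1 - 1 - x, c2 - 1 - y)"
      using ab by (auto simp: reflect_eq Delta_iff)
    then show False using Delta_gamma_minus_mem[OF assms] by blast
  qed
  ultimately show "\<beta> \<in> Apery S" by (auto simp: Apery_iff Delta_def)
qed

text \<open>Translate a point outside \<open>S\<close> by \<open>(e1, e2)\<close> until the next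
  translate lies in \<open>S\<close>; that translate is an Apery element, so the hypothesis applies
  to it. Adding \<open>(e1, e2)\<close> to elements of \<open>Delta\<close> carries nonemptiness
  back to the original point.\<close>

lemma Delta_reflect_nonempty_imp_symmetric:
  assumes nonempty: "\<And>x y. (x, y) \<in> Apery S \<Longrightarrow> Delta S (reflect S (x, y)) \<noteq> {}"
  shows "symmetric S"
proof -
  have ne: "Delta S (c1 - 1 - x, c2 - 1 - y) \<noteq> {}" if "(x, y) \<notin> S" for x y
    using that
  proof (induction "nat (c1 - x) + nat (c2 - y)" arbitrary: x y rule: less_induct)
    case less
    show ?case
    proof (cases "(x + e1, y + e2) \<in> S")
      case True
      then show ?thesis using nonempty[of "x + e1" "y + e2"] less.prems
        by (simp add: Apery_iff reflect_eq)
    next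
      case False
      have "x < c1 \<or> y < c2" using less.prems conductor_mem[of x y] by linarith
      then have "nat (c1 - (x + e1)) + nat (c2 - (y + e2)) < nat (c1 - x) + nat (c2 - y)"
        using e1_pos e2_pos by linarith
      from less.hyps[OF this False] obtain a b
        where "(a, b) \<in> Delta S (c1 - 1 - (x + e1), c2 - 1 - (y + e2))" by auto
      then have "(a + e1, b + e2) \<in> Delta S (c1 - 1 - x, c2 - 1 - y)"
        using mem_shift[of "a + e1" "b + e2"] by (auto simp: Delta_iff)
      then show ?thesis by blast
    qed
  qed
  show ?thesis
    unfolding symmetric_def
  proof (intro allI impI)
    fix \<alpha> :: point
    obtain x y where "\<alpha> = (x, y)" by fastforce
    then show "\<alpha> \<in> S \<longleftrightarrow> Delta S (gamma S - \<alpha>) = {}"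
      using ne[of x y] Delta_gamma_minus_mem[of x y] by (auto simp: gamma_minus)
  qed
qed

section \<open>Consequences of symmetry\<close>

lemma symmetric_mem:
  assumes "symmetric S" "Delta S (c1 - 1 - x, c2 - 1 - y) = {}"
  shows "(x, y) \<in> S"
proof -
  \<comment> \<open>\<open>symmetric\<close> speaks of nonnegative points only. For a negative
    component the reflected column or row lies beyond the conductor, so \<open>Delta\<close> is
    nonempty.\<close>
  have "0 \<le> x"
  proof (rule ccontr)
    assume "\<not> 0 \<le> x"
    then have "has_above (c1 - 1 - x) (c2 - 1 - y + 1)" by (intro has_above_conductor) auto
    then show False using assms(2) by (simp add: Delta_empty_iff)
  qed
  moreover have "0 \<le> y"
  proof (rule ccontr)
    assume "\<not> 0 \<le> y"
    then have "has_right (c1 - 1 - x + 1) (c2 - 1 - y)" by (intro has_right_conductor) auto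
    then show False using assms(2) by (simp add: Delta_empty_iff)
  qed
  ultimately have "0 \<le> (x, y)" by (simp add: less_eq_prod_def)
  then show ?thesis using assms unfolding symmetric_def gamma_minus[symmetric] by blast
qed

lemma ex_greatest_int:
  fixes P :: "int \<Rightarrow> bool"
  assumes "P k" "\<And>n. P n \<Longrightarrow> n \<le> u"
  obtains m where "P m" "\<And>n. P n \<Longrightarrow> n \<le> m"
proof -
  obtain m where m: "P m" "\<And>n. P n \<Longrightarrow> nat (u - m) \<le> nat (u - n)"
    using ex_has_least_nat[of P k "\<lambda>n. nat (u - n)"] assms(1) by blast
  have "n \<le> m" if "P n" for n
    using m(2)[OF that] assms(2)[OF that] assms(2)[OF m(1)] by linarith
  then show thesis using that m(1) by blast
qed

text \<open>Symmetry for single steps. If both columns stopped too early, the top element of column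
  \<open>c1 - 1 - x\<close> would have nothing above it, hence by (G2) nothing to its right. Its
  \<open>Delta\<close> would be empty, and symmetry would put its reflection into \<open>S\<close>,
  in column \<open>x\<close> at height at least \<open>y\<close>.\<close>

lemma symmetric_has_above:
  assumes sym: "symmetric S"
  shows "has_above (c1 - 1 - x) (c2 - y) \<longleftrightarrow> \<not> has_above x y"
proof (rule iffI)
  assume "\<not> has_above x y"
  then have no: "(x, b) \<notin> S" if "y \<le> b" for b using that by (auto simp: has_above_def)
  show "has_above (c1 - 1 - x) (c2 - y)"
  proof (rule ccontr)
    assume no': "\<not> has_above (c1 - 1 - x) (c2 - y)"
    \<comment> \<open>Taking \<open>z\<close> at least \<open>c2\<close> makes the row
      \<open>c2 - 1 - z\<close> negative, so only the column can contribute to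
      \<open>Delta\<close>.\<close>
    define z where "z = max y c2"
    have "Delta S (c1 - 1 - x, c2 - 1 - z) \<noteq> {}"
      using symmetric_mem[OF sym] no[of z] unfolding z_def by auto
    moreover have "\<not> has_right (c1 - 1 - x + 1) (c2 - 1 - z)"
      unfolding has_right_def z_def using nonneg by fastforce
    ultimately have "\<exists>k. (c1 - 1 - x, k) \<in> S"
      unfolding Delta_empty_iff has_above_def by blast
    moreover have "n \<le> c2 - 1 - y" if "(c1 - 1 - x, n) \<in> S" for n
    proof (rule ccontr)
      assume "\<not> n \<le> c2 - 1 - y"
      then have "c2 - y \<le> n" by simp
      then show False using no' that unfolding has_above_def by blast
    qed
    ultimately obtain m where m: "(c1 - 1 - x, m) \<in> S" "\<And>n. (c1 - 1 - x, n) \<in> S \<Longrightarrow> n \<le> m"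
      "m \<le> c2 - 1 - y"
      using ex_greatest_int[of "\<lambda>n. (c1 - 1 - x, n) \<in> S" _ "c2 - 1 - y"] by metis
    have "\<not> has_above (c1 - 1 - x) (m + 1)" using m(2) unfolding has_above_def by force
    then have "Delta S (c1 - 1 - x, c2 - 1 - (c2 - 1 - m)) = {}"
      using has_above_iff_has_right[OF m(1)] by (simp add: Delta_empty_iff)
    from symmetric_mem[OF sym this] show False using no[of "c2 - 1 - m"] m(3) by simp
  qed
qed (use not_has_above_both in blast)

lemma symmetric_has_right:
  assumes sym: "symmetric S"
  shows "has_right (c1 - x) (c2 - 1 - y) \<longleftrightarrow> \<not> has_right x y"
proof (rule iffI)
  assume "\<not> has_right x y"
  then have no: "(a, y) \<notin> S" if "x \<le> a" for a using that by (auto simp: has_right_def)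
  show "has_right (c1 - x) (c2 - 1 - y)"
  proof (rule ccontr)
    assume no': "\<not> has_right (c1 - x) (c2 - 1 - y)"
    define z where "z = max x c1"
    have "Delta S (c1 - 1 - z, c2 - 1 - y) \<noteq> {}"
      using symmetric_mem[OF sym] no[of z] unfolding z_def by auto
    moreover have "\<not> has_above (c1 - 1 - z) (c2 - 1 - y + 1)"
      unfolding has_above_def z_def using nonneg by fastforce
    ultimately have "\<exists>k. (k, c2 - 1 - y) \<in> S"
      unfolding Delta_empty_iff has_right_def by blast
    moreover have "n \<le> c1 - 1 - x" if "(n, c2 - 1 - y) \<in> S" for n
    proof (rule ccontr)
      assume "\<not> n \<le> c1 - 1 - x"
      then have "c1 - x \<le> n" by simp
      then show False using no' that unfolding has_right_def by blast
    qed
    ultimately obtain m where m: "(m, c2 - 1 - y) \<in> S" "\<And>n. (n, c2 - 1 - y) \<in> S \<Longrightarrow> n \<le> m"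
      "m \<le> c1 - 1 - x"
      using ex_greatest_int[of "\<lambda>n. (n, c2 - 1 - y) \<in> S" _ "c1 - 1 - x"] by metis
    have "\<not> has_right (m + 1) (c2 - 1 - y)" using m(2) unfolding has_right_def by force
    then have "Delta S (c1 - 1 - (c1 - 1 - m), c2 - 1 - y) = {}"
      using has_above_iff_has_right[OF m(1)] by (simp add: Delta_empty_iff)
    from symmetric_mem[OF sym this] show False using no[of "c1 - 1 - m"] m(3) by simp
  qed
qed (use not_has_right_both in blast)

text \<open>Reflection exchanges \<open>S\<close> and \<open>e + S\<close>: the loss of one at a
  step is complementary to the loss of the other at the reflected step, so the sum is constant in
  each direction. Its value is read off at the origin.\<close>

lemma symmetric_rlen:
  assumes sym: "symmetric S"
  shows "rlen x y + rlen (c1 + e1 - x) (c2 + e2 - y) = max_rlen"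
proof -
  define f where "f x y = rlen x y + rlen (c1 + e1 - x) (c2 + e2 - y)" for x y
  have right: "f (x + 1) y = f x y" for x y
    using rlen_right[of x y] rlen_right[of "c1 + e1 - (x + 1)" "c2 + e2 - y"]
      symmetric_has_above[OF sym, of x y] symmetric_has_above[OF sym, of "x - e1" "y - e2"]
    unfolding f_def by (simp add: algebra_simps of_bool_not_iff)
  have up: "f x (y + 1) = f x y" for x y
    using rlen_up[of x y] rlen_up[of "c1 + e1 - x" "c2 + e2 - (y + 1)"]
      symmetric_has_right[OF sym, of x y] symmetric_has_right[OF sym, of "x - e1" "y - e2"]
    unfolding f_def by (simp add: algebra_simps of_bool_not_iff)
  have "f x y = f 0 y" for x y
    by (induction x rule: int_induct[where k = 0]) (use right[of "_ - 1"] right in auto)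
  moreover have "f 0 y = f 0 0" for y
    by (induction y rule: int_induct[where k = 0]) (use up[of _ "_ - 1"] up in auto)
  ultimately have "f x y = f 0 0" by metis
  then show ?thesis unfolding f_def by (simp add: rlen_zero max_rlen_def)
qed

text \<open>Together these give the least value of \<open>rlen\<close> on
  \<open>Delta S (reflect S (x, y))\<close>. All its points lie above \<open>(u, v + 1)\<close> or
  \<open>(u + 1, v)\<close>, one unit step before \<open>(u + 1, v + 1)\<close>, where the value is
  known. Symmetry at \<open>(x - e1, y - e2)\<close> makes one of these steps costly, and walking on
  to the first element of \<open>S\<close> does not change \<open>rlen\<close>.\<close>

lemma symmetric_neighbours:
  assumes sym: "symmetric S" and A: "(x, y) \<in> Apery S"
  shows neighbour_rlen_ge: "(a, b) \<in> Delta S (reflect S (x, y)) \<Longrightarrow> max_rlen - 1 - rlen x y \<le> rlen a b"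
    and ex_neighbour_rlen: "\<exists>(a, b)\<in>Delta S (reflect S (x, y)). rlen a b = max_rlen - 1 - rlen x y"
proof -
  define u v where "u = c1 - 1 + e1 - x" and "v = c2 - 1 + e2 - y"
  have S: "(x, y) \<in> S" and E: "(x - e1, y - e2) \<notin> S" using A by (auto simp: Apery_iff)
  have uv: "reflect S (x, y) = (u, v)" by (simp add: reflect_eq u_def v_def)
  have tot: "rlen (u + 1) (v + 1) = max_rlen - rlen x y"
    using symmetric_rlen[OF sym, of x y] by (simp add: u_def v_def algebra_simps)
  \<comment> \<open>\<open>e + S\<close> loses nothing at this step, since \<open>(x, y)\<close>
    lies in \<open>S\<close>; the same holds for the other step below.\<close>
  have rE: "rlen (u + 1) v = rlen (u + 1) (v + 1) - of_bool (has_right (u + 1) v)"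
    using rlen_up[of "u + 1" v] not_has_right_both[of x y] S mem_iff_has[of x y]
    by (auto simp: u_def v_def algebra_simps)
  have aE: "rlen u (v + 1) = rlen (u + 1) (v + 1) - of_bool (has_above u (v + 1))"
    using rlen_right[of u "v + 1"] not_has_above_both[of x y] S mem_iff_has[of x y]
    by (auto simp: u_def v_def algebra_simps)
  show "max_rlen - 1 - rlen x y \<le> rlen a b" if "(a, b) \<in> Delta S (reflect S (x, y))"
    using that rE aE tot rlen_mono[of "u + 1" a v b] rlen_mono[of u a "v + 1" b]
    unfolding uv Delta_iff by (auto simp: of_bool_def split: if_splits)
  have "has_above u (v + 1) \<or> has_right (u + 1) v"
    using symmetric_mem[OF sym, of "x - e1" "y - e2"] E
    by (auto simp: Delta_empty_iff u_def v_def algebra_simps)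
  then show "\<exists>(a, b)\<in>Delta S (reflect S (x, y)). rlen a b = max_rlen - 1 - rlen x y"
  proof
    assume h: "has_above u (v + 1)"
    then obtain b where "v + 1 \<le> b" "(u, b) \<in> S" "rlen u b = rlen u (v + 1)"
      using ex_above_rlen by blast
    then show ?thesis using aE h tot unfolding uv by (intro bexI[of _ "(u, b)"]) (auto simp: Delta_iff)
  next
    assume h: "has_right (u + 1) v"
    then obtain a where "u + 1 \<le> a" "(a, v) \<in> S" "rlen a v = rlen (u + 1) v"
      using ex_right_rlen by blast
    then show ?thesis using rE h tot unfolding uv by (intro bexI[of _ "(a, v)"]) (auto simp: Delta_iff)
  qed
qed

text \<open>By \<open>Delta_reflect_sym\<close>, a point lies in the dual level \<open>i\<close> iff
  \<open>i - 1\<close> is the least value of \<open>rlen\<close> on the \<open>Delta\<close> of its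
  reflection, which \<open>symmetric_neighbours\<close> computes.\<close>

lemma symmetric_dual_level:
  assumes sym: "symmetric S" and i: "1 \<le> i" "i \<le> num_levels S"
  shows "dual_level S i = level S (num_levels S - i + 1)"
proof -
  have mem: "(a, b) \<in> (\<Union>\<omega>\<in>level S j. Delta S (reflect S \<omega>)) \<longleftrightarrow>
      (\<exists>(x, y)\<in>Delta S (reflect S (a, b)). rlen x y = int j - 1)"
    if "(a, b) \<in> Apery S" "1 \<le> j" "j \<le> num_levels S" for a b j
  proof -
    have "(a, b) \<in> S" using that by (simp add: Apery_iff)
    have "(a, b) \<in> (\<Union>\<omega>\<in>level S j. Delta S (reflect S \<omega>)) \<longleftrightarrow>
        (\<exists>x y. (x, y) \<in> Apery S \<and> rlen x y = int j - 1 \<and> (a, b) \<in> Delta S (reflect S (x, y)))"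
      using that by (force simp: level_eq)
    also have "\<dots> \<longleftrightarrow> (\<exists>x y. (x, y) \<in> Delta S (reflect S (a, b)) \<and> rlen x y = int j - 1)"
      using Delta_reflect_sym[OF _ \<open>(a, b) \<in> S\<close>] Delta_reflect_subset_Apery[OF \<open>(a, b) \<in> S\<close>]
        Apery_iff by blast
    finally show ?thesis by blast
  qed
  have sub: "dual_level S i \<subseteq> Apery S"
    using Delta_reflect_subset_Apery i unfolding dual_level_def by (force simp: level_eq Apery_iff)
  have "(a, b) \<in> dual_level S i \<longleftrightarrow> rlen a b = max_rlen - int i" if A: "(a, b) \<in> Apery S" for a b
  proof -
    define P where "P j \<longleftrightarrow> (\<exists>(x, y)\<in>Delta S (reflect S (a, b)). rlen x y = int j - 1)" for j
    have lower: "max_rlen - rlen a b \<le> int j" if "P j" for j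
      using that neighbour_rlen_ge[OF sym A] unfolding P_def by fastforce
    have attained: "P j" if "int j = max_rlen - rlen a b" for j
      using that ex_neighbour_rlen[OF sym A] unfolding P_def by (auto intro: bexI[rotated])
    have "(a, b) \<in> dual_level S i \<longleftrightarrow> P i \<and> (\<forall>j\<in>{1..<i}. \<not> P j)"
      using mem[OF A] i unfolding dual_level_def P_def by simp
    also have "\<dots> \<longleftrightarrow> int i = max_rlen - rlen a b"
    proof
      assume *: "P i \<and> (\<forall>j\<in>{1..<i}. \<not> P j)"
      have "P (nat (max_rlen - rlen a b))" using rlen_less_max[OF A] by (intro attained) simp
      then have "nat (max_rlen - rlen a b) \<notin> {1..<i}" using * by blast
      then show "int i = max_rlen - rlen a b" using * lower[of i] rlen_less_max[OF A] by auto
    next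
      assume *: "int i = max_rlen - rlen a b"
      have "\<not> P j" if "j \<in> {1..<i}" for j using lower[of j] * that by auto
      then show "P i \<and> (\<forall>j\<in>{1..<i}. \<not> P j)" using attained * by blast
    qed
    finally show ?thesis by auto
  qed
  moreover have "level S (num_levels S - i + 1) = {(a, b). (a, b) \<in> Apery S \<and> rlen a b = max_rlen - int i}"
    using i num_levels_eq by (subst level_eq) (auto simp: of_nat_diff)
  ultimately show ?thesis using sub by fastforce
qed

text \<open>Each Apery element lies in some level, hence in a dual level, hence in the
  \<open>Delta\<close> of a reflected element of \<open>S\<close>; exchanging the two points shows
  that its own \<open>Delta\<close> is nonempty.\<close>

lemma dual_level_imp_symmetric:
  assumes dual: "\<And>i. 1 \<le> i \<Longrightarrow> i \<le> num_levels S \<Longrightarrow> dual_level S i = level S (num_levels S - i + 1)"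
  shows "symmetric S"
proof (rule Delta_reflect_nonempty_imp_symmetric)
  fix x y assume A: "(x, y) \<in> Apery S"
  then obtain i where i: "1 \<le> i" "i \<le> num_levels S" "(x, y) \<in> level S i"
    using Apery_eq_levels by auto
  define j where "j = num_levels S - i + 1"
  have j: "1 \<le> j" "j \<le> num_levels S" "num_levels S - j + 1 = i" using i by (auto simp: j_def)
  with dual[of j] i(3) have "(x, y) \<in> dual_level S j" by simp
  then obtain a b where "(a, b) \<in> level S j" and xy: "(x, y) \<in> Delta S (reflect S (a, b))"
    unfolding dual_level_def by auto
  then have "(a, b) \<in> S" "(x, y) \<in> S" using j A by (auto simp: level_eq Apery_iff)
  with xy show "Delta S (reflect S (x, y)) \<noteq> {}" using Delta_reflect_sym by blast
qed

end

theorem theorem5p3: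
  fixes S :: "(int \<times> int) set" and e :: nat
  assumes "good_semigroup S" and "local_semigroup S"
    and "e = num_levels S"
  shows "symmetric S \<longleftrightarrow> (\<forall>i\<in>{1..e}. dual_level S i = level S (e - i + 1))"
proof -
  interpret local_good_semigroup S using assms by unfold_locales
  show ?thesis using symmetric_dual_level dual_level_imp_symmetric assms(3) by auto
qed

end
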